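(* Let $I$ and $J$ be arbitrary sets and let $\{a_i\}_{i\in I}$ and $\{b_j\}_{j\in J}$ be arrays of complex (or real) numbers. Suppose that the arrays $\{a_i\}_{i\in I}$, $\{b_j\}_{j\in J}$ and their direct product $\{a_ib_j\}_{(i,j)\in I\times J}$ are all greedy summable. Then their greedy sums satisfy $$\sum_{(i,j)\in I\times J} a_ib_j=\left(\sum_{i\in I} a_i\right)\left(\sum_{j\in J} b_j\right),$$ where each of the three sums denotes the greedy sum of the corresponding array.
   Context: An array of numbers $\{a_i\}_{i\in I}$ over $I$ is a family of complex or real numbers indexed by a set $I$ of arbitrary nature. The direct product of arrays $\{a_i\}_{i\in I}$ and $\{b_j\}_{j\in J}$ is the array $\{a_ib_j\}_{(i,j)\in I\times J}$. For an array $\{a_i\}_{i\in I}$ and a real number $\varepsilon>0$, the $\varepsilon$-partial sum is $\sum_{|a_i|\ge\varepsilon}a_i$ (the sum over all $i\in I$ with $|a_i|\ge\varepsilon$); it exists if and only if it contains a finite number of summands, i.e. the set $\{i\in I : |a_i|\ge\varepsilon\}$ is finite. The greedy sum of the array, denoted $\sum_{i\in I}a_i$, is the limit $\lim_{\varepsilon\to 0^+}\sum_{|a_i|\ge\varepsilon}a_i$ of the $\varepsilon$-partial sums. The array is called greedy summable if it has a greedy sum, i.e. all $\varepsilon$-partial sums ($\varepsilon>0$) exist and this limit exists as a finite number. *)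

theory Defs
  imports "HOL-Analysis.Analysis"
begin

definition eps_index_set :: "('i \<Rightarrow> 'a::real_normed_vector) \<Rightarrow> 'i set \<Rightarrow> real \<Rightarrow> 'i set" where
  "eps_index_set a I \<epsilon> = {i \<in> I. norm (a i) \<ge> \<epsilon>}"

(* sum returns 0 on an infinite index set, so this is the partial sum only where
   eps_index_set a I \<epsilon> is finite; greedy_summable requires that for every \<epsilon> > 0. *)
definition eps_partial_sum :: "('i \<Rightarrow> 'a::real_normed_vector) \<Rightarrow> 'i set \<Rightarrow> real \<Rightarrow> 'a" where
  "eps_partial_sum a I \<epsilon> = (\<Sum>i\<in>eps_index_set a I \<epsilon>. a i)"

definition greedy_summable :: "('i \<Rightarrow> 'a::real_normed_vector) \<Rightarrow> 'i set \<Rightarrow> bool" where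
  "greedy_summable a I \<longleftrightarrow>
     (\<forall>\<epsilon>>0. finite (eps_index_set a I \<epsilon>)) \<and>
     (\<exists>s. (eps_partial_sum a I \<longlongrightarrow> s) (at_right 0))"

(* Meaningful only for greedy summable arrays, like Lim itself. *)
definition greedy_sum :: "('i \<Rightarrow> 'a::real_normed_vector) \<Rightarrow> 'i set \<Rightarrow> 'a" where
  "greedy_sum a I = Lim (at_right 0) (eps_partial_sum a I)"

definition direct_product :: "('i \<Rightarrow> 'a::real_normed_field) \<Rightarrow> ('j \<Rightarrow> 'a) \<Rightarrow> 'i \<times> 'j \<Rightarrow> 'a" where
  "direct_product a b = (\<lambda>(i, j). a i * b j)"

end

theory Submission
  imports Defs
begin

text \<open>
  Rescale the arrays by upper bounds \<open>M\<close>, \<open>N\<close> of the moduli and put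
  \<open>A(t) = (\<Sum>|a\<^sub>i| \<ge> M exp(-t). a\<^sub>i)\<close>, similarly \<open>B(t)\<close> with \<open>N\<close>, and \<open>C(t)\<close> for the direct
  product with \<open>M N\<close>. On the logarithmic scale the direct product becomes a convolution, so for
  \<open>S > 0\<close> (compare the coefficients of each \<open>a\<^sub>i b\<^sub>j\<close>)
  \<open>\<integral>\<^sub>0\<^sup>1 A(S u) B(S (1 - u)) du = \<integral>\<^sub>0\<^sup>1 C(S u) du\<close>.
  The partial sums are bounded and converge, so as \<open>S\<close> grows, dominated convergence turns this
  identity into the claim.
\<close>

section \<open>Convergence and boundedness of greedy summable arrays\<close>

lemma greedy_summable_tendsto:
  assumes "greedy_summable a I"
  shows "(eps_partial_sum a I \<longlongrightarrow> greedy_sum a I) (at_right 0)"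
  using assms tendsto_Lim[of "at_right (0::real)" "eps_partial_sum a I"]
  by (auto simp: greedy_summable_def greedy_sum_def)

text \<open>Only finitely many terms have modulus at least 1, so the maximum of 1 and their moduli
  is a bound. Including 1 keeps the bound positive even when there are no such terms.\<close>

lemma greedy_summable_bounded:
  assumes "greedy_summable a I"
  obtains M where "M > 0" "\<And>i. i \<in> I \<Longrightarrow> norm (a i) \<le> M"
proof -
  let ?E = "eps_index_set a I 1"
  have fin: "finite ?E"
    using assms by (simp add: greedy_summable_def)
  have "norm (a i) \<le> Max (insert 1 ((\<lambda>i. norm (a i)) ` ?E))" if "i \<in> I" for i
  proof (cases "i \<in> ?E")
    case False
    then have "norm (a i) \<le> 1"
      using that by (simp add: eps_index_set_def)
    also have "1 \<le> Max (insert 1 ((\<lambda>i. norm (a i)) ` ?E))"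
      using fin by (intro Max_ge) auto
    finally show ?thesis .
  qed (use fin in \<open>auto intro!: Max_ge\<close>)
  moreover have "0 < Max (insert 1 ((\<lambda>i. norm (a i)) ` ?E))"
    using fin by (intro less_le_trans[OF zero_less_one Max_ge]) auto
  ultimately show ?thesis
    using that by blast
qed

section \<open>Partial sums on the logarithmic scale\<close>

lemma exp_scaled_at_right_0:
  assumes "(M::real) > 0"
  shows "filterlim (\<lambda>t. M * exp (- t)) (at_right 0) at_top"
proof -
  have "((\<lambda>t. M * exp (- t)) \<longlongrightarrow> M * 0) at_top"
    by (intro tendsto_intros filterlim_compose[OF exp_at_bot] filterlim_uminus_at_bot_at_top)
  then show ?thesis
    using assms by (simp add: filterlim_at)
qed

lemma eps_partial_sum_exp_tendsto:
  assumes "greedy_summable a I" "M > 0"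
  shows "((\<lambda>t. eps_partial_sum a I (M * exp (- t))) \<longlongrightarrow> greedy_sum a I) at_top"
  by (rule filterlim_compose[OF greedy_summable_tendsto exp_scaled_at_right_0]) fact+

text \<open>Reads \<open>t\<close> as time: a nonzero term \<open>x\<close> enters the partial sum
  with threshold \<open>M * exp (- t)\<close> at time \<open>ln (M / norm x)\<close>.\<close>

lemma le_norm_exp_iff:
  assumes "M > 0" "x \<noteq> 0"
  shows "M * exp (- t) \<le> norm x \<longleftrightarrow> ln (M / norm x) \<le> t"
proof -
  have "ln (M / norm x) \<le> t \<longleftrightarrow> M / norm x \<le> exp t"
    using assms by (simp add: ln_le_cancel_iff[symmetric] del: ln_le_cancel_iff)
  then show ?thesis
    using assms by (simp add: exp_minus field_simps)
qed

lemma finite_eps_index_set: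
  assumes "greedy_summable a I" "\<epsilon> > 0"
  shows "finite (eps_index_set a I \<epsilon>)"
  using assms by (simp add: greedy_summable_def)

lemma eps_index_set_nonzero:
  assumes "\<epsilon> > 0" "i \<in> eps_index_set a I \<epsilon>"
  shows "a i \<noteq> 0"
  using assms by (auto simp: eps_index_set_def)

text \<open>Up to time \<open>T\<close> all partial sums become sums over one fixed finite index
  set, with \<open>t\<close> occurring only in the condition. Each summand is thus a step function
  of \<open>t\<close>, which can be integrated separately.\<close>

lemma eps_partial_sum_exp_eq:
  fixes M t T :: real
  assumes "M > 0" "t \<le> T" "finite (eps_index_set a I (M * exp (- T)))"
  shows "eps_partial_sum a I (M * exp (- t)) =
    (\<Sum>i\<in>eps_index_set a I (M * exp (- T)). if ln (M / norm (a i)) \<le> t then a i else 0)"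
proof -
  have "M * exp (- T) \<le> M * exp (- t)"
    using assms by simp
  moreover have "a i \<noteq> 0" if "i \<in> eps_index_set a I (M * exp (- T))" for i
    using that assms(1) by (intro eps_index_set_nonzero) auto
  ultimately have "i \<in> eps_index_set a I (M * exp (- t)) \<longleftrightarrow>
      i \<in> eps_index_set a I (M * exp (- T)) \<and> ln (M / norm (a i)) \<le> t" for i
    using le_norm_exp_iff[OF assms(1), of "a i" t] by (fastforce simp: eps_index_set_def)
  then have "eps_index_set a I (M * exp (- t)) =
      {i \<in> eps_index_set a I (M * exp (- T)). ln (M / norm (a i)) \<le> t}"
    by (intro set_eqI) simp
  then show ?thesis
    using assms(3) by (simp add: eps_partial_sum_def sum.inter_filter)
qed

text \<open>From some time \<open>T\<close> on, convergence keeps the partial sums within 1 of the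
  greedy sum. Before \<open>T\<close> they use only terms already present at \<open>T\<close>, so
  the finite sum of those moduli bounds them.\<close>

lemma eps_partial_sum_exp_bounded:
  assumes "greedy_summable a I" "M > 0"
  obtains K where "\<And>t. norm (eps_partial_sum a I (M * exp (- t))) \<le> K"
proof -
  let ?A = "\<lambda>t. eps_partial_sum a I (M * exp (- t))"
  have "\<forall>\<^sub>F t in at_top. dist (?A t) (greedy_sum a I) < 1"
    using eps_partial_sum_exp_tendsto[OF assms] by (rule tendstoD) simp
  then obtain T where T: "\<And>t. t \<ge> T \<Longrightarrow> dist (?A t) (greedy_sum a I) < 1"
    by (auto simp: eventually_at_top_linorder)
  let ?E = "eps_index_set a I (M * exp (- T))"
  have "norm (?A t) \<le> max (norm (greedy_sum a I) + 1) (\<Sum>i\<in>?E. norm (a i))" for t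
  proof (cases "t \<ge> T")
    case True
    then have "norm (?A t) \<le> norm (greedy_sum a I) + 1"
      using T[OF True] norm_triangle_sub[of "?A t" "greedy_sum a I"] by (simp add: dist_norm)
    then show ?thesis by simp
  next
    case False
    have "finite ?E"
      using assms by (simp add: finite_eps_index_set)
    then have "norm (?A t) \<le> (\<Sum>i\<in>?E. norm (a i))"
      using assms False
      by (subst eps_partial_sum_exp_eq[where T = T])
        (auto intro!: order.trans[OF norm_sum] sum_mono)
    then show ?thesis by simp
  qed
  with that show ?thesis by blast
qed

section \<open>Integrals of step functions and limits over the unit interval\<close>

lemma has_bochner_integral_indicator_Icc:
  fixes c :: "'a::{banach, second_countable_topology}"
  shows "has_bochner_integral lborel (\<lambda>u. indicator {l..r} u *\<^sub>R c) (max 0 (r - l) *\<^sub>R c)"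
proof (rule has_bochner_integral_scaleR_left)
  have "has_bochner_integral lborel (indicator {l..r}) (measure lborel {l..r})"
    by (rule has_bochner_integral_real_indicator) (auto simp: emeasure_lborel_Icc_eq)
  then show "has_bochner_integral lborel (indicator {l..r} :: real \<Rightarrow> real) (max 0 (r - l))"
    by (auto simp: max_def measure_def emeasure_lborel_Icc_eq split: if_splits)
qed

text \<open>Dominated convergence with a constant majorant on the unit interval. Convergence is
  asked only in the interior: in the application one factor stays at time 0 at each endpoint, and
  the endpoints form a null set.\<close>

lemma unit_interval_integral_tendsto:
  fixes F :: "nat \<Rightarrow> real \<Rightarrow> 'a::{banach, second_countable_topology}"
  assumes "\<And>n. (\<lambda>u. indicator {0..1} u *\<^sub>R F n u) \<in> borel_measurable lborel"
    and "\<And>n u. norm (F n u) \<le> K"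
    and "\<And>u. 0 < u \<Longrightarrow> u < 1 \<Longrightarrow> (\<lambda>n. F n u) \<longlonglongrightarrow> l"
  shows "(\<lambda>n. \<integral>u. indicator {0..1} u *\<^sub>R F n u \<partial>lborel) \<longlonglongrightarrow> l"
proof -
  have "(\<lambda>n. \<integral>u. indicator {0..1} u *\<^sub>R F n u \<partial>lborel)
      \<longlonglongrightarrow> (\<integral>u. indicator {0..1::real} u *\<^sub>R l \<partial>lborel)"
  proof (rule integral_dominated_convergence[where w = "\<lambda>u. indicator {0..1} u *\<^sub>R K"])
    show "AE u in lborel. (\<lambda>n. indicator {0..1} u *\<^sub>R F n u) \<longlonglongrightarrow> indicator {0..1} u *\<^sub>R l"
      using AE_lborel_singleton[of "0::real"] AE_lborel_singleton[of "1::real"]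
    proof eventually_elim
      case (elim u)
      then show ?case
        using assms(3)[of u] by (cases "0 < u \<and> u < 1") (auto simp: indicator_def)
    qed
    show "integrable lborel (\<lambda>u. indicator {0..1::real} u *\<^sub>R K)"
      by (rule integrable.intros[OF has_bochner_integral_indicator_Icc])
  qed (use assms in \<open>auto simp: indicator_def\<close>)
  then show ?thesis by simp
qed

section \<open>The convolution identity\<close>

text \<open>If \<open>a i\<close> enters at time \<open>p\<close> and \<open>b j\<close> at time
  \<open>q\<close>, then \<open>a i * b j\<close> is counted in the first integrand for
  \<open>u\<close> in \<open>{p / S..1 - q / S}\<close> and in the second for \<open>u\<close> in
  \<open>{(p + q) / S..1}\<close>. These intervals have the same length.\<close>

lemma direct_product_integrals:
  fixes a :: "'i \<Rightarrow> 'a::{real_normed_field, banach, second_countable_topology}"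
    and b :: "'j \<Rightarrow> 'a"
  assumes a: "greedy_summable a I" and M: "M > 0" "\<And>i. i \<in> I \<Longrightarrow> norm (a i) \<le> M"
    and b: "greedy_summable b J" and N: "N > 0" "\<And>j. j \<in> J \<Longrightarrow> norm (b j) \<le> N"
    and S: "S > 0"
  obtains v where
    "has_bochner_integral lborel (\<lambda>u. indicator {0..1} u *\<^sub>R
      (eps_partial_sum a I (M * exp (- (S * u))) * eps_partial_sum b J (N * exp (- (S * (1 - u)))))) v"
    "has_bochner_integral lborel (\<lambda>u. indicator {0..1} u *\<^sub>R
      eps_partial_sum (direct_product a b) (I \<times> J) (M * N * exp (- (S * u)))) v"
proof -
  \<comment> \<open>For \<open>u\<close> in the unit interval neither \<open>S * u\<close> nor
    \<open>S * (1 - u)\<close> exceeds \<open>S\<close>, so the index sets at time \<open>S\<close>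
    contain every term that can occur.\<close>
  define E where "E = eps_index_set a I (M * exp (- S))"
  define F where "F = eps_index_set b J (N * exp (- S))"
  define G where "G = eps_index_set (direct_product a b) (I \<times> J) (M * N * exp (- S))"
  define p where "p i = ln (M / norm (a i))" for i
  define q where "q j = ln (N / norm (b j))" for j
  have fin: "finite E" "finite F"
    using a b M N by (simp_all add: E_def F_def finite_eps_index_set)
  have E: "i \<in> I" "a i \<noteq> 0" "p i \<ge> 0" if "i \<in> E" for i
    using that M eps_index_set_nonzero[of "M * exp (- S)" i a I]
    by (auto simp: E_def eps_index_set_def p_def intro!: ln_ge_zero)
  have F: "j \<in> J" "b j \<noteq> 0" "q j \<ge> 0" if "j \<in> F" for j
    using that N eps_index_set_nonzero[of "N * exp (- S)" j b J]
    by (auto simp: F_def eps_index_set_def q_def intro!: ln_ge_zero)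
  \<comment> \<open>One factor of a product is at most its bound \<open>M\<close> or
    \<open>N\<close>, so a product of modulus at least \<open>M * N * exp (- S)\<close> forces the
    other factor above its own threshold.\<close>
  have G: "G \<subseteq> E \<times> F"
  proof clarify
    fix i j assume "(i, j) \<in> G"
    then have ij: "i \<in> I" "j \<in> J" "M * N * exp (- S) \<le> norm (a i) * norm (b j)"
      by (auto simp: G_def eps_index_set_def direct_product_def norm_mult)
    have "norm (a i) * norm (b j) \<le> norm (a i) * N" "norm (a i) * norm (b j) \<le> M * norm (b j)"
      using ij M N by (auto intro: mult_left_mono mult_right_mono)
    then have "N * (M * exp (- S)) \<le> N * norm (a i)" "M * (N * exp (- S)) \<le> M * norm (b j)"
      using ij(3) by (auto simp: mult_ac)
    then show "i \<in> E \<and> j \<in> F"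
      using ij M N by (simp add: E_def F_def eps_index_set_def)
  qed
  \<comment> \<open>The logarithm makes entry times additive under products.\<close>
  have pq: "ln (M * N / norm (direct_product a b (i, j))) = p i + q j" if "i \<in> E" "j \<in> F" for i j
  proof -
    have "M * N / norm (direct_product a b (i, j)) = (M / norm (a i)) * (N / norm (b j))"
      by (simp add: direct_product_def norm_mult)
    also have "ln \<dots> = p i + q j"
      unfolding p_def q_def using E(2)[OF that(1)] F(2)[OF that(2)] M(1) N(1)
      by (intro ln_mult_pos) auto
    finally show ?thesis .
  qed
  \<comment> \<open>The coefficient is the common length of the two intervals; \<open>max 0\<close>
    covers \<open>p i + q j > S\<close>, where both are empty.\<close>
  define v where "v = (\<Sum>(i, j)\<in>E \<times> F. max 0 (1 - (p i + q j) / S) *\<^sub>R (a i * b j))"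
  have "has_bochner_integral lborel
      (\<lambda>u. \<Sum>(i, j)\<in>E \<times> F. indicator {p i / S..1 - q j / S} u *\<^sub>R (a i * b j)) v"
    unfolding v_def split_beta
    using has_bochner_integral_indicator_Icc[of "p i / S" "1 - q j / S" "a i * b j" for i j]
    by (intro has_bochner_integral_sum) (simp add: add_divide_distrib algebra_simps)
  moreover have "(\<lambda>u. indicator {0..1} u *\<^sub>R (eps_partial_sum a I (M * exp (- (S * u))) *
        eps_partial_sum b J (N * exp (- (S * (1 - u)))))) =
      (\<lambda>u. \<Sum>(i, j)\<in>E \<times> F. indicator {p i / S..1 - q j / S} u *\<^sub>R (a i * b j))"
  proof
    fix u :: real
    show "indicator {0..1} u *\<^sub>R (eps_partial_sum a I (M * exp (- (S * u))) *
        eps_partial_sum b J (N * exp (- (S * (1 - u))))) =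
      (\<Sum>(i, j)\<in>E \<times> F. indicator {p i / S..1 - q j / S} u *\<^sub>R (a i * b j))"
    proof (cases "u \<in> {0..1}")
      case True
      then have "S * u \<le> S" "S * (1 - u) \<le> S"
        using S by (auto simp: mult_le_cancel_left1)
      then have "indicator {0..1} u *\<^sub>R (eps_partial_sum a I (M * exp (- (S * u))) *
          eps_partial_sum b J (N * exp (- (S * (1 - u))))) =
        (\<Sum>i\<in>E. if p i \<le> S * u then a i else 0) * (\<Sum>j\<in>F. if q j \<le> S * (1 - u) then b j else 0)"
        using True M(1) N(1) fin
        by (simp add: eps_partial_sum_exp_eq[where T = S] E_def F_def p_def q_def)
      also have "\<dots> = (\<Sum>(i, j)\<in>E \<times> F. indicator {p i / S..1 - q j / S} u *\<^sub>R (a i * b j))"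
        unfolding sum_product sum.cartesian_product
        by (intro sum.cong) (use S in \<open>auto simp: indicator_def field_simps\<close>)
      finally show ?thesis .
    next
      case False
      \<comment> \<open>Entry times are nonnegative, so the interval lies inside the unit interval
        and the sum of indicators vanishes outside it too.\<close>
      have "u \<notin> {p i / S..1 - q j / S}" if "i \<in> E" "j \<in> F" for i j
        using False divide_nonneg_pos[OF E(3)[OF that(1)] S] divide_nonneg_pos[OF F(3)[OF that(2)] S]
        by auto
      then have "(\<Sum>(i, j)\<in>E \<times> F. indicator {p i / S..1 - q j / S} u *\<^sub>R (a i * b j)) = 0"
        by (intro sum.neutral) (auto simp: indicator_def)
      then show ?thesis
        using False by simp
    qed
  qed
  moreover have "has_bochner_integral lborel
      (\<lambda>u. \<Sum>(i, j)\<in>E \<times> F. indicator {(p i + q j) / S..1} u *\<^sub>R (a i * b j)) v"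
    unfolding v_def split_beta
    by (intro has_bochner_integral_sum has_bochner_integral_indicator_Icc)
  moreover have "(\<lambda>u. indicator {0..1} u *\<^sub>R
        eps_partial_sum (direct_product a b) (I \<times> J) (M * N * exp (- (S * u)))) =
      (\<lambda>u. \<Sum>(i, j)\<in>E \<times> F. indicator {(p i + q j) / S..1} u *\<^sub>R (a i * b j))"
  proof
    fix u :: real
    show "indicator {0..1} u *\<^sub>R
        eps_partial_sum (direct_product a b) (I \<times> J) (M * N * exp (- (S * u))) =
      (\<Sum>(i, j)\<in>E \<times> F. indicator {(p i + q j) / S..1} u *\<^sub>R (a i * b j))"
    proof (cases "u \<in> {0..1}")
      case True
      then have u: "S * u \<le> S"
        using S by (auto simp: mult_le_cancel_left1)
      have "finite G"
        using G fin by (meson finite_SigmaI finite_subset)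
      then have "indicator {0..1} u *\<^sub>R
          eps_partial_sum (direct_product a b) (I \<times> J) (M * N * exp (- (S * u))) =
        (\<Sum>x\<in>G. if ln (M * N / norm (direct_product a b x)) \<le> S * u
          then direct_product a b x else 0)"
        using True M(1) N(1) u by (simp add: eps_partial_sum_exp_eq[where T = S] G_def)
      also have "\<dots> = (\<Sum>(i, j)\<in>E \<times> F. indicator {(p i + q j) / S..1} u *\<^sub>R (a i * b j))"
      \<comment> \<open>The sum is extended from \<open>G\<close> to the full rectangle: a pair
        outside \<open>G\<close> enters only after time \<open>S\<close>, so its indicator is
        zero.\<close>
      proof (intro sum.mono_neutral_cong_left ballI)
        fix x assume "x \<in> E \<times> F - G"
        then obtain i j where x: "x = (i, j)" "i \<in> E" "j \<in> F" "x \<notin> G"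
          by auto
        then have "\<not> M * N * exp (- S) \<le> norm (direct_product a b x)"
          using E(1) F(1) by (auto simp: G_def eps_index_set_def)
        moreover have "direct_product a b x \<noteq> 0"
          using x E(2) F(2) by (auto simp: direct_product_def)
        ultimately have "\<not> p i + q j \<le> S"
          using le_norm_exp_iff[of "M * N" "direct_product a b x" S] M(1) N(1) pq x by simp
        then show "(case x of (i, j) \<Rightarrow> indicator {(p i + q j) / S..1} u *\<^sub>R (a i * b j)) = 0"
          using x S order.trans[OF _ u] by (auto simp: indicator_def pos_divide_le_eq mult.commute)
      next
        fix x assume "x \<in> G"
        then obtain i j where x: "x = (i, j)" "i \<in> E" "j \<in> F"
          using G by auto
        then show "(if ln (M * N / norm (direct_product a b x)) \<le> S * u
            then direct_product a b x else 0) =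
          (case x of (i, j) \<Rightarrow> indicator {(p i + q j) / S..1} u *\<^sub>R (a i * b j))"
          using True S pq by (auto simp: indicator_def field_simps direct_product_def)
      qed (use fin G in auto)
      finally show ?thesis .
    next
      case False
      have "u \<notin> {(p i + q j) / S..1}" if "i \<in> E" "j \<in> F" for i j
        using False divide_nonneg_pos[OF add_nonneg_nonneg[OF E(3)[OF that(1)] F(3)[OF that(2)]] S]
        by auto
      then have "(\<Sum>(i, j)\<in>E \<times> F. indicator {(p i + q j) / S..1} u *\<^sub>R (a i * b j)) = 0"
        by (intro sum.neutral) (auto simp: indicator_def)
      then show ?thesis
        using False by simp
    qed
  qed
  ultimately show ?thesis
    using that by simp
qed

section \<open>Passage to the limit\<close>

text \<open>The type class covers the complex and the real case at once; completeness and second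
  countability serve the dominated convergence theorem for Bochner integrals.\<close>

lemma greedy_sum_direct_product:
  fixes a :: "'i \<Rightarrow> 'a::{real_normed_field, banach, second_countable_topology}"
    and b :: "'j \<Rightarrow> 'a"
  assumes a: "greedy_summable a I" and b: "greedy_summable b J"
    and c: "greedy_summable (direct_product a b) (I \<times> J)"
  shows "greedy_sum (direct_product a b) (I \<times> J) = greedy_sum a I * greedy_sum b J"
proof -
  obtain M where M: "M > 0" "\<And>i. i \<in> I \<Longrightarrow> norm (a i) \<le> M"
    using greedy_summable_bounded[OF a] by blast
  obtain N where N: "N > 0" "\<And>j. j \<in> J \<Longrightarrow> norm (b j) \<le> N"
    using greedy_summable_bounded[OF b] by blast
  define A where "A t = eps_partial_sum a I (M * exp (- t))" for t
  define B where "B t = eps_partial_sum b J (N * exp (- t))" for t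
  define C where "C t = eps_partial_sum (direct_product a b) (I \<times> J) (M * N * exp (- t))" for t
  have MN: "M * N > 0"
    using M N by simp
  obtain KA where KA: "\<And>t. norm (A t) \<le> KA"
    using eps_partial_sum_exp_bounded[OF a M(1)] unfolding A_def by blast
  obtain KB where KB: "\<And>t. norm (B t) \<le> KB"
    using eps_partial_sum_exp_bounded[OF b N(1)] unfolding B_def by blast
  obtain KC where KC: "\<And>t. norm (C t) \<le> KC"
    using eps_partial_sum_exp_bounded[OF c MN] unfolding C_def by blast
  \<comment> \<open>The scale \<open>S\<close> runs through the positive integers, since dominated
    convergence is applied along a sequence and the convolution identity asks for
    \<open>S > 0\<close>.\<close>
  have int: "\<exists>v. has_bochner_integral lborel
        (\<lambda>u. indicator {0..1} u *\<^sub>R (A (real (Suc n) * u) * B (real (Suc n) * (1 - u)))) v \<and>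
      has_bochner_integral lborel (\<lambda>u. indicator {0..1} u *\<^sub>R C (real (Suc n) * u)) v" for n
    unfolding A_def B_def C_def
    by (rule direct_product_integrals[OF a M b N, of "real (Suc n)"]) auto
  have lim: "filterlim (\<lambda>n. real (Suc n) * x) at_top sequentially" if "x > 0" for x
    using that
    by (intro filterlim_at_top_mult_tendsto_pos[OF tendsto_const]
        filterlim_compose[OF filterlim_real_sequentially filterlim_Suc])
  have AB: "(\<lambda>n. \<integral>u. indicator {0..1} u *\<^sub>R (A (real (Suc n) * u) * B (real (Suc n) * (1 - u))) \<partial>lborel)
      \<longlonglongrightarrow> greedy_sum a I * greedy_sum b J"
  proof (rule unit_interval_integral_tendsto)
    show "norm (A (real (Suc n) * u) * B (real (Suc n) * (1 - u))) \<le> KA * KB" for n u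
      unfolding norm_mult by (intro mult_mono KA KB) (auto intro: order.trans[OF norm_ge_zero KA])
    \<comment> \<open>For interior \<open>u\<close> both \<open>u\<close> and \<open>1 - u\<close>
      are positive, so both times tend to infinity and each factor tends to its greedy sum.\<close>
    show "(\<lambda>n. A (real (Suc n) * u) * B (real (Suc n) * (1 - u)))
        \<longlonglongrightarrow> greedy_sum a I * greedy_sum b J" if "0 < u" "u < 1" for u
      using that unfolding A_def B_def
      by (intro tendsto_mult filterlim_compose[OF eps_partial_sum_exp_tendsto[OF a M(1)] lim]
          filterlim_compose[OF eps_partial_sum_exp_tendsto[OF b N(1)] lim]) auto
  qed (use int in \<open>blast dest: borel_measurable_has_bochner_integral\<close>)
  have C: "(\<lambda>n. \<integral>u. indicator {0..1} u *\<^sub>R C (real (Suc n) * u) \<partial>lborel)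
      \<longlonglongrightarrow> greedy_sum (direct_product a b) (I \<times> J)"
  proof (rule unit_interval_integral_tendsto)
    show "(\<lambda>n. C (real (Suc n) * u)) \<longlonglongrightarrow> greedy_sum (direct_product a b) (I \<times> J)"
      if "0 < u" "u < 1" for u
      using that(1) unfolding C_def
      by (intro filterlim_compose[OF eps_partial_sum_exp_tendsto[OF c MN] lim])
  qed (use int KC in \<open>blast dest: borel_measurable_has_bochner_integral\<close>)+
  have AB_eq_C: "(\<integral>u. indicator {0..1} u *\<^sub>R (A (real (Suc n) * u) * B (real (Suc n) * (1 - u))) \<partial>lborel)
      = (\<integral>u. indicator {0..1} u *\<^sub>R C (real (Suc n) * u) \<partial>lborel)" for n
    using int[of n] by (elim exE conjE) (simp only: has_bochner_integral_integral_eq)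
  show ?thesis
    by (rule LIMSEQ_unique[OF C AB[unfolded AB_eq_C]])
qed

theorem theorem1:
  fixes I :: "'i set" and J :: "'j set"
  shows "(\<forall>(a :: 'i \<Rightarrow> complex) (b :: 'j \<Rightarrow> complex).
            greedy_summable a I \<longrightarrow> greedy_summable b J \<longrightarrow>
            greedy_summable (direct_product a b) (I \<times> J) \<longrightarrow>
            greedy_sum (direct_product a b) (I \<times> J) = greedy_sum a I * greedy_sum b J) \<and>
         (\<forall>(a :: 'i \<Rightarrow> real) (b :: 'j \<Rightarrow> real).
            greedy_summable a I \<longrightarrow> greedy_summable b J \<longrightarrow>
            greedy_summable (direct_product a b) (I \<times> J) \<longrightarrow>
            greedy_sum (direct_product a b) (I \<times> J) = greedy_sum a I * greedy_sum b J)"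
  by (intro conjI allI impI greedy_sum_direct_product)

end
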